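(* Fix a date $t<T$, a history $h_t$ and vintages $s,s'\le t$. (i) If $s\sim_{t,h_t}s'$, then $V_{s,j}^{\pi}(h_j)=V_{s',j}^{\pi}(h_j)$ for every descendant $h_j\succeq h_t$, every bounded reward system, and every continuation policy $\pi$. (ii) If $s\not\sim_{t,h_t}s'$ and the reward class is locally continuation-rich, there are a bounded reward system in the class and a continuation policy for which the two vintage values differ at some descendant node in the subtree rooted at $h_t$. (iii) Consequently, an exact triangular recursion may retain one valuation coordinate per class of $\sim_{t,h_t}$ (on the subtree, all values $V_{s,j}^\pi$, $s\le t$, are determined by one representative per class, for every bounded reward system and policy). Under local continuation richness, no two distinct classes can be merged by a universal coordinate-identification rule (i.e. a rule identifying the two value coordinates at all descendant nodes for all reward systems in the class and all continuation policies).
   Context: Finite controlled event tree: dates $t=0,\dots,T$; finitely many histories at each date; at each $h_t$ with $t<T$ a finite nonempty action set $\mathcal A_t(h_t)$; after action $a$, an observation $y$ in a finite set $\mathcal Y_{t+1}(h_t,a)$, leading to $(h_t,a,y)$. $h_j\succeq h_t$ means $h_j$ equals $h_t$ or is a descendant of it. Discount $\beta\in(0,1]$. For $0\le s\le t<T$, $\mathcal K_{s,t}(h_t,a)\subseteq\Delta(\mathcal Y_{t+1}(h_t,a))$ is a nonempty compact set (one-step kernels of evaluator vintage $s$ at date $t$). Given rewards $r_t(h,a)$, $g(h_T)$ and a policy $\pi$: $V_{s,T}^\pi=g$ and $V_{s,t}^\pi(h_t)=r_t(h_t,\pi_t(h_t))+\beta\inf_{q\in\mathcal K_{s,t}(h_t,\pi_t(h_t))}\sum_yq(y)V_{s,t+1}^\pi(h_t,\pi_t(h_t),y)$.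 For nonempty compact $A,B$ in a finite-dimensional simplex, $D_{\rm op}(A,B)=\sup_{\|z\|_\infty\le1}|\inf_{p\in A}p^\top z-\inf_{p\in B}p^\top z|$. Vintages $s,s'\le t$ are future operationally equivalent, $s\sim_{t,h_t}s'$, if $D_{\rm op}(\mathcal K_{s,j}(h_j,a),\mathcal K_{s',j}(h_j,a))=0$ for every date $t\le j<T$, every descendant history $h_j\succeq h_t$ and every $a\in\mathcal A_j(h_j)$. A class of bounded reward systems is locally continuation-rich if, at every descendant history–action pair $(h_j,a)$, every sufficiently small bounded vector $(z(y))_y$ over the next observations can be realized as a common next-date continuation value by independently assigning rewards on the successor subtrees: some reward system in the class and some continuation policy $\pi$ give $V_{\sigma,j+1}^\pi(h_j,a,y)=z(y)$ for all $y$ and all active vintages $\sigma$. *)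

theory Defs
  imports "HOL-Analysis.Analysis"
begin

text \<open>A history is the root it started from together with the actions and observations that
  followed; \<open>Step h a y\<close> is $(h,a,y)$.\<close>

datatype ('i, 'a, 'y) history =
    Root 'i
  | Step "('i, 'a, 'y) history" 'a 'y

text \<open>Kernels are functions on the whole type \<open>'y\<close> that vanish off the (finite) observation set.
  On such functions the product topology of \<^typ>\<open>'y \<Rightarrow> real\<close> is the Euclidean topology of the simplex,
  so \<^const>\<open>compact\<close> has its usual meaning.\<close>

definition prob_simplex :: "'y set \<Rightarrow> ('y \<Rightarrow> real) set" where
  "prob_simplex Y = {q. (\<forall>y\<in>Y. 0 \<le> q y) \<and> (\<forall>y. y \<notin> Y \<longrightarrow> q y = 0) \<and> (\<Sum>y\<in>Y. q y) = 1}"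

text \<open>Indexing: \<open>actions M t h\<close> is $\mathcal A_t(h)$, \<open>observations M (Suc t) h a\<close> is
  $\mathcal Y_{t+1}(h,a)$ and \<open>kernels M s t h a\<close> is $\mathcal K_{s,t}(h,a)$. Values of these functions
  at arguments outside the tree are irrelevant.\<close>

record ('i, 'a, 'y) evaluation_tree =
  horizon :: nat
  roots :: "'i set"
  actions :: "nat \<Rightarrow> ('i, 'a, 'y) history \<Rightarrow> 'a set"
  observations :: "nat \<Rightarrow> ('i, 'a, 'y) history \<Rightarrow> 'a \<Rightarrow> 'y set"
  discount :: real
  kernels :: "nat \<Rightarrow> nat \<Rightarrow> ('i, 'a, 'y) history \<Rightarrow> 'a \<Rightarrow> ('y \<Rightarrow> real) set"

primrec histories :: "('i, 'a, 'y) evaluation_tree \<Rightarrow> nat \<Rightarrow> ('i, 'a, 'y) history set" where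
  "histories M 0 = Root ` roots M"
| "histories M (Suc t) =
     {Step h a y | h a y. h \<in> histories M t \<and> a \<in> actions M t h \<and> y \<in> observations M (Suc t) h a}"

definition wf_tree :: "('i, 'a, 'y) evaluation_tree \<Rightarrow> bool" where
  "wf_tree M \<longleftrightarrow>
     finite (roots M) \<and>
     0 < discount M \<and> discount M \<le> 1 \<and>
     (\<forall>t<horizon M. \<forall>h\<in>histories M t.
        finite (actions M t h) \<and> actions M t h \<noteq> {} \<and>
        (\<forall>a\<in>actions M t h.
           finite (observations M (Suc t) h a) \<and>
           (\<forall>s\<le>t. kernels M s t h a \<noteq> {} \<and> compact (kernels M s t h a) \<and>
                  kernels M s t h a \<subseteq> prob_simplex (observations M (Suc t) h a))))"

inductive descends :: "('i, 'a, 'y) history \<Rightarrow> ('i, 'a, 'y) history \<Rightarrow> bool"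
  for h :: "('i, 'a, 'y) history" where
  refl: "descends h h"
| step: "descends h k \<Longrightarrow> descends h (Step k a y)"

definition subtree ::
  "('i, 'a, 'y) evaluation_tree \<Rightarrow> ('i, 'a, 'y) history \<Rightarrow> nat \<Rightarrow> ('i, 'a, 'y) history set" where
  "subtree M h j = {k \<in> histories M j. descends h k}"

record ('i, 'a, 'y) reward_system =
  stage_reward :: "nat \<Rightarrow> ('i, 'a, 'y) history \<Rightarrow> 'a \<Rightarrow> real"
  terminal_reward :: "('i, 'a, 'y) history \<Rightarrow> real"

definition bounded_rewards ::
  "('i, 'a, 'y) evaluation_tree \<Rightarrow> ('i, 'a, 'y) reward_system \<Rightarrow> bool" where
  "bounded_rewards M R \<longleftrightarrow>
     (\<exists>B. (\<forall>t<horizon M. \<forall>h\<in>histories M t. \<forall>a\<in>actions M t h. \<bar>stage_reward R t h a\<bar> \<le> B) \<and>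
          (\<forall>h\<in>histories M (horizon M). \<bar>terminal_reward R h\<bar> \<le> B))"

text \<open>A continuation policy at \<open>h\<close> (a history of date \<open>t\<close>) prescribes a feasible action at every
  nonterminal node of the subtree rooted at \<open>h\<close>.\<close>

definition continuation_policy ::
  "('i, 'a, 'y) evaluation_tree \<Rightarrow> nat \<Rightarrow> ('i, 'a, 'y) history \<Rightarrow>
   (nat \<Rightarrow> ('i, 'a, 'y) history \<Rightarrow> 'a) \<Rightarrow> bool" where
  "continuation_policy M t h \<pi> \<longleftrightarrow>
     (\<forall>j k. t \<le> j \<and> j < horizon M \<and> k \<in> subtree M h j \<longrightarrow> \<pi> j k \<in> actions M j k)"

text \<open>\<open>vintage_value M R \<pi> s t h\<close> is $V_{s,t}^\pi(h)$.\<close>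

function vintage_value ::
  "('i, 'a, 'y) evaluation_tree \<Rightarrow> ('i, 'a, 'y) reward_system \<Rightarrow>
   (nat \<Rightarrow> ('i, 'a, 'y) history \<Rightarrow> 'a) \<Rightarrow> nat \<Rightarrow> nat \<Rightarrow> ('i, 'a, 'y) history \<Rightarrow> real" where
  "vintage_value M R \<pi> s t h =
     (if horizon M \<le> t then terminal_reward R h
      else stage_reward R t h (\<pi> t h) +
        discount M *
          (INF q\<in>kernels M s t h (\<pi> t h).
             \<Sum>y\<in>observations M (Suc t) h (\<pi> t h).
               q y * vintage_value M R \<pi> s (Suc t) (Step h (\<pi> t h) y)))"
  by pat_completeness auto
termination
  by (relation "Wellfounded.measure (\<lambda>(M, R, \<pi>, s, t, h). horizon M - t)") auto

declare vintage_value.simps [simp del]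

text \<open>For subsets of \<open>prob_simplex Y\<close>; only the values of \<open>z\<close> on \<open>Y\<close> matter.\<close>

definition D_op :: "'y set \<Rightarrow> ('y \<Rightarrow> real) set \<Rightarrow> ('y \<Rightarrow> real) set \<Rightarrow> real" where
  "D_op Y A B =
     (SUP z\<in>{z :: 'y \<Rightarrow> real. \<forall>y\<in>Y. \<bar>z y\<bar> \<le> 1}.
        \<bar>(INF p\<in>A. \<Sum>y\<in>Y. p y * z y) - (INF p\<in>B. \<Sum>y\<in>Y. p y * z y)\<bar>)"

definition future_equiv ::
  "('i, 'a, 'y) evaluation_tree \<Rightarrow> nat \<Rightarrow> ('i, 'a, 'y) history \<Rightarrow> nat \<Rightarrow> nat \<Rightarrow> bool" where
  "future_equiv M t h s s' \<longleftrightarrow>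
     (\<forall>j k a. t \<le> j \<and> j < horizon M \<and> k \<in> subtree M h j \<and> a \<in> actions M j k \<longrightarrow>
        D_op (observations M (Suc j) k a) (kernels M s j k a) (kernels M s' j k a) = 0)"

definition vintage_rel ::
  "('i, 'a, 'y) evaluation_tree \<Rightarrow> nat \<Rightarrow> ('i, 'a, 'y) history \<Rightarrow> (nat \<times> nat) set" where
  "vintage_rel M t h = {(s, s'). s \<le> t \<and> s' \<le> t \<and> future_equiv M t h s s'}"

definition vintage_classes ::
  "('i, 'a, 'y) evaluation_tree \<Rightarrow> nat \<Rightarrow> ('i, 'a, 'y) history \<Rightarrow> nat set set" where
  "vintage_classes M t h = {..t} // vintage_rel M t h"

text \<open>The next facts show that \<open>vintage_rel\<close> is an equivalence relation, so that
  \<open>vintage_classes\<close> is a partition of \<open>{..t}\<close>.\<close>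

lemma expectation_bound:
  assumes "p \<in> prob_simplex Y" and "\<forall>y\<in>Y. \<bar>z y\<bar> \<le> (c::real)"
  shows "\<bar>\<Sum>y\<in>Y. p y * z y\<bar> \<le> c"
proof -
  have p: "\<forall>y\<in>Y. 0 \<le> p y" "(\<Sum>y\<in>Y. p y) = 1"
    using assms(1) by (auto simp: prob_simplex_def)
  have "\<bar>\<Sum>y\<in>Y. p y * z y\<bar> \<le> (\<Sum>y\<in>Y. \<bar>p y * z y\<bar>)" by (rule sum_abs)
  also have "\<dots> \<le> (\<Sum>y\<in>Y. p y * c)"
    by (rule sum_mono) (use p assms(2) in \<open>auto simp: abs_mult intro!: mult_left_mono\<close>)
  also have "\<dots> = c" using p(2) by (simp flip: sum_distrib_right)
  finally show ?thesis .
qed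

lemma INF_expectation_bound:
  assumes "A \<noteq> {}" "A \<subseteq> prob_simplex Y" and "\<forall>y\<in>Y. \<bar>z y\<bar> \<le> (c::real)"
  shows "\<bar>INF p\<in>A. \<Sum>y\<in>Y. p y * z y\<bar> \<le> c"
proof -
  have b: "\<bar>\<Sum>y\<in>Y. p y * z y\<bar> \<le> c" if "p \<in> A" for p
    using expectation_bound[of p Y z c] that assms(2,3) by blast
  obtain p where p: "p \<in> A" using assms(1) by blast
  have bb: "bdd_below ((\<lambda>p. \<Sum>y\<in>Y. p y * z y) ` A)"
    using b abs_le_D2 minus_le_iff by (intro bdd_belowI2[of _ "- c"]) blast
  have "(INF p\<in>A. \<Sum>y\<in>Y. p y * z y) \<le> (\<Sum>y\<in>Y. p y * z y)"
    by (rule cINF_lower[OF bb p])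
  also have "\<dots> \<le> c" using b[OF p] by linarith
  finally have "(INF p\<in>A. \<Sum>y\<in>Y. p y * z y) \<le> c" .
  moreover have "- c \<le> (INF p\<in>A. \<Sum>y\<in>Y. p y * z y)"
    using assms(1) b abs_le_D2 minus_le_iff by (intro cINF_greatest) blast+
  ultimately show ?thesis by linarith
qed

lemma D_op_eq_0_iff:
  assumes "A \<noteq> {}" "A \<subseteq> prob_simplex Y" "B \<noteq> {}" "B \<subseteq> prob_simplex Y"
  shows "D_op Y A B = 0 \<longleftrightarrow>
    (\<forall>z :: 'y \<Rightarrow> real. (\<forall>y\<in>Y. \<bar>z y\<bar> \<le> 1) \<longrightarrow>
       (INF p\<in>A. \<Sum>y\<in>Y. p y * z y) = (INF p\<in>B. \<Sum>y\<in>Y. p y * z y))"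
proof -
  let ?Z = "{z :: 'y \<Rightarrow> real. \<forall>y\<in>Y. \<bar>z y\<bar> \<le> 1}"
  let ?d = "\<lambda>z. \<bar>(INF p\<in>A. \<Sum>y\<in>Y. p y * z y) - (INF p\<in>B. \<Sum>y\<in>Y. p y * z y)\<bar>"
  have "?d z \<le> 2" if "z \<in> ?Z" for z
    using INF_expectation_bound[OF assms(1,2), of z 1]
      INF_expectation_bound[OF assms(3,4), of z 1] that by auto
  then have bdd: "bdd_above (?d ` ?Z)" by (rule bdd_aboveI2)
  have ne: "?Z \<noteq> {}" by (auto intro!: exI[of _ "\<lambda>_. 0"])
  have "(SUP z\<in>?Z. ?d z) = 0 \<longleftrightarrow> (\<forall>z\<in>?Z. ?d z = 0)"
  proof
    assume s0: "(SUP z\<in>?Z. ?d z) = 0"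
    show "\<forall>z\<in>?Z. ?d z = 0"
    proof
      fix z assume "z \<in> ?Z"
      from cSUP_upper[OF this bdd] s0 show "?d z = 0" by linarith
    qed
  next
    assume all0: "\<forall>z\<in>?Z. ?d z = 0"
    have "(SUP z\<in>?Z. ?d z) = (SUP z\<in>?Z. 0)" using all0 by (intro SUP_cong) auto
    also have "\<dots> = 0" using ne by simp
    finally show "(SUP z\<in>?Z. ?d z) = 0" .
  qed
  then show ?thesis unfolding D_op_def by auto
qed

lemma equiv_vintage_rel:
  assumes "wf_tree M"
  shows "equiv {..t} (vintage_rel M t h)"
proof -
  have K: "kernels M s j k a \<noteq> {}" "kernels M s j k a \<subseteq> prob_simplex (observations M (Suc j) k a)"
    if "s \<le> t" "t \<le> j" "j < horizon M" "k \<in> subtree M h j" "a \<in> actions M j k" for s j k a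
    using assms that unfolding wf_tree_def subtree_def by auto
  have iff: "future_equiv M t h s s' \<longleftrightarrow>
      (\<forall>j k a. t \<le> j \<and> j < horizon M \<and> k \<in> subtree M h j \<and> a \<in> actions M j k \<longrightarrow>
        (\<forall>z. (\<forall>y\<in>observations M (Suc j) k a. \<bar>z y\<bar> \<le> 1) \<longrightarrow>
          (INF p\<in>kernels M s j k a. \<Sum>y\<in>observations M (Suc j) k a. p y * z y) =
          (INF p\<in>kernels M s' j k a. \<Sum>y\<in>observations M (Suc j) k a. p y * z y)))"
    if "s \<le> t" "s' \<le> t" for s s'
  proof -
    have "D_op (observations M (Suc j) k a) (kernels M s j k a) (kernels M s' j k a) = 0 \<longleftrightarrow>
        (\<forall>z. (\<forall>y\<in>observations M (Suc j) k a. \<bar>z y\<bar> \<le> 1) \<longrightarrow>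
          (INF p\<in>kernels M s j k a. \<Sum>y\<in>observations M (Suc j) k a. p y * z y) =
          (INF p\<in>kernels M s' j k a. \<Sum>y\<in>observations M (Suc j) k a. p y * z y))"
      if "t \<le> j \<and> j < horizon M \<and> k \<in> subtree M h j \<and> a \<in> actions M j k" for j k a
      using that \<open>s \<le> t\<close> \<open>s' \<le> t\<close> by (intro D_op_eq_0_iff K) auto
    then show ?thesis unfolding future_equiv_def by (simp cong: imp_cong)
  qed
  have trans: "future_equiv M t h x z"
    if "x \<le> t" "y \<le> t" "z \<le> t" "future_equiv M t h x y" "future_equiv M t h y z" for x y z
    using that(4,5) unfolding iff[OF that(1,2)] iff[OF that(2,3)] iff[OF that(1,3)] by simp
  show ?thesis
  proof (rule equivI)
    show "vintage_rel M t h \<subseteq> {..t} \<times> {..t}" by (auto simp: vintage_rel_def)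
    show "refl_on {..t} (vintage_rel M t h)"
      by (auto simp: refl_on_def vintage_rel_def iff)
    show "sym (vintage_rel M t h)"
      by (rule symI) (simp add: vintage_rel_def future_equiv_def D_op_def abs_minus_commute)
    show "trans (vintage_rel M t h)"
      by (rule transI) (use trans in \<open>auto simp: vintage_rel_def\<close>)
  qed
qed

text \<open>The active vintages at the node \<open>h\<close> of date \<open>t\<close> are those with index at most \<open>t\<close>. The bound
  \<open>\<epsilon>\<close> of "sufficiently small" may depend on the history-action pair.\<close>

definition locally_continuation_rich ::
  "('i, 'a, 'y) evaluation_tree \<Rightarrow> nat \<Rightarrow> ('i, 'a, 'y) history \<Rightarrow>
   ('i, 'a, 'y) reward_system set \<Rightarrow> bool" where
  "locally_continuation_rich M t h \<R> \<longleftrightarrow>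
     (\<forall>j k a. t \<le> j \<and> j < horizon M \<and> k \<in> subtree M h j \<and> a \<in> actions M j k \<longrightarrow>
        (\<exists>\<epsilon>>0. \<forall>z :: 'y \<Rightarrow> real.
           (\<forall>y\<in>observations M (Suc j) k a. \<bar>z y\<bar> \<le> \<epsilon>) \<longrightarrow>
           (\<exists>R\<in>\<R>. \<exists>\<pi>. continuation_policy M t h \<pi> \<and>
              (\<forall>y\<in>observations M (Suc j) k a. \<forall>\<sigma>\<le>t.
                 vintage_value M R \<pi> \<sigma> (Suc j) (Step k a y) = z y))))"

text \<open>A recursion on the subtree rooted at \<open>h\<close> that carries a single coordinate \<open>W c\<close> for each class
  \<open>c\<close> and uses only the kernels of the representative \<open>\<rho> c\<close>.\<close>

definition class_recursion ::
  "('i, 'a, 'y) evaluation_tree \<Rightarrow> nat \<Rightarrow> ('i, 'a, 'y) history \<Rightarrow> (nat set \<Rightarrow> nat) \<Rightarrow>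
   ('i, 'a, 'y) reward_system \<Rightarrow> (nat \<Rightarrow> ('i, 'a, 'y) history \<Rightarrow> 'a) \<Rightarrow>
   (nat set \<Rightarrow> nat \<Rightarrow> ('i, 'a, 'y) history \<Rightarrow> real) \<Rightarrow> bool" where
  "class_recursion M t h \<rho> R \<pi> W \<longleftrightarrow>
     (\<forall>c\<in>vintage_classes M t h.
        (\<forall>k\<in>subtree M h (horizon M). W c (horizon M) k = terminal_reward R k) \<and>
        (\<forall>j k. t \<le> j \<and> j < horizon M \<and> k \<in> subtree M h j \<longrightarrow>
           W c j k = stage_reward R j k (\<pi> j k) +
             discount M *
               (INF q\<in>kernels M (\<rho> c) j k (\<pi> j k).
                  \<Sum>y\<in>observations M (Suc j) k (\<pi> j k). q y * W c (Suc j) (Step k (\<pi> j k) y))))"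

definition universally_identified ::
  "('i, 'a, 'y) evaluation_tree \<Rightarrow> nat \<Rightarrow> ('i, 'a, 'y) history \<Rightarrow>
   ('i, 'a, 'y) reward_system set \<Rightarrow> nat \<Rightarrow> nat \<Rightarrow> bool" where
  "universally_identified M t h \<R> s s' \<longleftrightarrow>
     (\<forall>R\<in>\<R>. \<forall>\<pi>. continuation_policy M t h \<pi> \<longrightarrow>
        (\<forall>j k. t \<le> j \<and> j \<le> horizon M \<and> k \<in> subtree M h j \<longrightarrow>
           vintage_value M R \<pi> s j k = vintage_value M R \<pi> s' j k))"

end

theory Submission
  imports Defs
begin

text \<open>Two vintages enter the recursion only through the support functions
  \<open>z \<mapsto> INF p\<in>K. \<Sum>y. p y * z y\<close> of their kernel sets, and \<open>D_op\<close> vanishes exactly when two such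
  functions agree on the unit ball of the sup norm, hence, by positive homogeneity, everywhere
  (\<open>D_op_eq_0_imp_INF_expectation_eq\<close>). So equivalent vintages satisfy the same backward recursion
  on the subtree. Backward recursions have only one solution (\<open>vintage_value_unique\<close>), which gives
  the equality of values and also shows that a recursion that carries one coordinate per class
  computes all of them.

  Conversely, if two vintages are not equivalent, then some pair \<open>(k, a)\<close> and some vector \<open>z\<close> in the
  unit ball separate their support functions. Homogeneity allows \<open>z\<close> to be shrunk to a size at which
  continuation richness realizes it as a continuation value common to both vintages. The policy
  that realizes it need not choose \<open>a\<close> at \<open>k\<close>, but redirecting it there does not disturb the values
  at later dates. One step of the recursion at \<open>k\<close> then adds the same stage reward to two different
  discounted worst-case expectations, so the values at \<open>k\<close> differ
  (\<open>not_future_equiv_imp_values_differ\<close>).\<close>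

lemma INF_expectation_scale:
  fixes c :: real
  assumes "finite Y" "A \<noteq> {}" "A \<subseteq> prob_simplex Y" "0 < c"
  shows "(INF p\<in>A. \<Sum>y\<in>Y. p y * (c * z y)) = c * (INF p\<in>A. \<Sum>y\<in>Y. p y * z y)"
proof -
  let ?f = "\<lambda>p. \<Sum>y\<in>Y. p y * z y"
  have bound: "\<bar>?f p\<bar> \<le> (\<Sum>y\<in>Y. \<bar>z y\<bar>)" if "p \<in> A" for p
    using that assms(1,3) by (intro expectation_bound[of p Y z]) (auto intro!: member_le_sum)
  have bdd: "bdd_below (?f ` A)"
    using bound abs_le_D2 minus_le_iff
    by (intro bdd_belowI2[of _ "- (\<Sum>y\<in>Y. \<bar>z y\<bar>)"]) blast
  have "(INF p\<in>A. c * ?f p) = c * (INF p\<in>A. ?f p)"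
  proof (rule cInf_eq_non_empty)
    show "(\<lambda>p. c * ?f p) ` A \<noteq> {}" using assms(2) by simp
  next
    fix x assume "x \<in> (\<lambda>p. c * ?f p) ` A"
    then obtain p where "p \<in> A" "x = c * ?f p" by blast
    then show "c * (INF p\<in>A. ?f p) \<le> x"
      using cINF_lower[OF bdd \<open>p \<in> A\<close>] assms(4) by simp
  next
    fix l assume l: "\<And>x. x \<in> (\<lambda>p. c * ?f p) ` A \<Longrightarrow> l \<le> x"
    have "l / c \<le> (INF p\<in>A. ?f p)"
      using assms(2,4) l by (intro cINF_greatest) (auto simp: divide_le_eq mult.commute)
    then show "l \<le> c * (INF p\<in>A. ?f p)"
      using assms(4) by (simp add: divide_le_eq mult.commute)
  qed
  then show ?thesis by (simp add: sum_distrib_left mult.left_commute)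
qed

text \<open>On a finite set every vector is a positive multiple of one in the unit ball, and both sides are positively
  homogeneous.\<close>

lemma D_op_eq_0_imp_INF_expectation_eq:
  assumes "finite Y" and A: "A \<noteq> {}" "A \<subseteq> prob_simplex Y" and B: "B \<noteq> {}" "B \<subseteq> prob_simplex Y"
    and "D_op Y A B = 0"
  shows "(INF p\<in>A. \<Sum>y\<in>Y. p y * z y) = (INF p\<in>B. \<Sum>y\<in>Y. p y * z y)"
proof -
  define c where "c = 1 + (\<Sum>y\<in>Y. \<bar>z y\<bar>)"
  have c: "0 < c" unfolding c_def by (intro add_pos_nonneg sum_nonneg) auto
  have "\<bar>z y / c\<bar> \<le> 1" if "y \<in> Y" for y
  proof -
    have "\<bar>z y\<bar> \<le> (\<Sum>y\<in>Y. \<bar>z y\<bar>)" using that assms(1) by (intro member_le_sum) auto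
    then show ?thesis using c by (simp add: c_def abs_divide)
  qed
  then have "(INF p\<in>A. \<Sum>y\<in>Y. p y * (z y / c)) = (INF p\<in>B. \<Sum>y\<in>Y. p y * (z y / c))"
    using assms(6) unfolding D_op_eq_0_iff[OF A B] by (elim allE[of _ "\<lambda>y. z y / c"]) blast
  then show ?thesis
    using c INF_expectation_scale[OF assms(1) A c, of "\<lambda>y. z y / c"]
      INF_expectation_scale[OF assms(1) B c, of "\<lambda>y. z y / c"] by simp
qed

lemma wf_tree_kernel:
  assumes "wf_tree M" "j < horizon M" "k \<in> subtree M h j" "a \<in> actions M j k"
  shows "finite (observations M (Suc j) k a)"
    and "\<sigma> \<le> j \<Longrightarrow> kernels M \<sigma> j k a \<noteq> {}"
    and "\<sigma> \<le> j \<Longrightarrow> kernels M \<sigma> j k a \<subseteq> prob_simplex (observations M (Suc j) k a)"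
  using assms unfolding wf_tree_def subtree_def by auto

lemma Step_in_subtree:
  assumes "k \<in> subtree M h j" "a \<in> actions M j k" "y \<in> observations M (Suc j) k a"
  shows "Step k a y \<in> subtree M h (Suc j)"
  using assms by (auto simp: subtree_def intro: descends.step)

lemma vintage_value_terminal: "vintage_value M R \<pi> \<sigma> (horizon M) k = terminal_reward R k"
  by (simp add: vintage_value.simps)

lemma vintage_value_step:
  assumes "j < horizon M"
  shows "vintage_value M R \<pi> \<sigma> j k = stage_reward R j k (\<pi> j k) +
    discount M * (INF q\<in>kernels M \<sigma> j k (\<pi> j k). \<Sum>y\<in>observations M (Suc j) k (\<pi> j k).
      q y * vintage_value M R \<pi> \<sigma> (Suc j) (Step k (\<pi> j k) y))"
  using assms by (subst vintage_value.simps) simp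

text \<open>The recursion refers only to the next date, and a continuation policy never leaves the
  subtree, so backward induction from the horizon applies.\<close>

lemma vintage_value_unique:
  assumes "continuation_policy M t h \<pi>"
    and terminal: "\<And>k. k \<in> subtree M h (horizon M) \<Longrightarrow> W (horizon M) k = terminal_reward R k"
    and step: "\<And>j k. t \<le> j \<Longrightarrow> j < horizon M \<Longrightarrow> k \<in> subtree M h j \<Longrightarrow>
      W j k = stage_reward R j k (\<pi> j k) +
        discount M * (INF q\<in>kernels M \<sigma> j k (\<pi> j k). \<Sum>y\<in>observations M (Suc j) k (\<pi> j k).
          q y * W (Suc j) (Step k (\<pi> j k) y))"
    and "j \<le> horizon M" "t \<le> j" "k \<in> subtree M h j"
  shows "vintage_value M R \<pi> \<sigma> j k = W j k"
  using assms(4-6)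
proof (induction j arbitrary: k rule: inc_induct)
  case base
  then show ?case by (simp add: terminal vintage_value_terminal)
next
  case (step j)
  have "\<pi> j k \<in> actions M j k"
    using assms(1) step.hyps step.prems by (auto simp: continuation_policy_def)
  then have "vintage_value M R \<pi> \<sigma> (Suc j) (Step k (\<pi> j k) y) = W (Suc j) (Step k (\<pi> j k) y)"
    if "y \<in> observations M (Suc j) k (\<pi> j k)" for y
    using that step.IH step.prems Step_in_subtree by fastforce
  then show ?case
    using step.hyps step.prems by (simp add: vintage_value_step assms(3) cong: sum.cong)
qed

lemma future_equiv_imp_values_eq:
  assumes "wf_tree M" "s \<le> t" "s' \<le> t" "future_equiv M t h s s'" "continuation_policy M t h \<pi>"
    and "t \<le> j" "j \<le> horizon M" "k \<in> subtree M h j"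
  shows "vintage_value M R \<pi> s j k = vintage_value M R \<pi> s' j k"
proof (rule vintage_value_unique[OF assms(5) _ _ assms(7,6,8)])
  fix j k assume jk: "t \<le> j" "j < horizon M" "k \<in> subtree M h j"
  let ?a = "\<pi> j k" and ?z = "\<lambda>y. vintage_value M R \<pi> s' (Suc j) (Step k (\<pi> j k) y)"
  let ?Y = "observations M (Suc j) k ?a"
  have a: "?a \<in> actions M j k" using assms(5) jk by (auto simp: continuation_policy_def)
  have "D_op ?Y (kernels M s j k ?a) (kernels M s' j k ?a) = 0"
    using assms(4) jk a by (auto simp: future_equiv_def)
  then have "(INF q\<in>kernels M s j k ?a. \<Sum>y\<in>?Y. q y * ?z y) =
      (INF q\<in>kernels M s' j k ?a. \<Sum>y\<in>?Y. q y * ?z y)"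
    using assms(2,3) jk wf_tree_kernel[OF assms(1) jk(2,3) a]
    by (intro D_op_eq_0_imp_INF_expectation_eq) auto
  then show "vintage_value M R \<pi> s' j k = stage_reward R j k ?a +
      discount M * (INF q\<in>kernels M s j k ?a. \<Sum>y\<in>?Y. q y * ?z y)"
    using jk(2) by (simp add: vintage_value_step)
qed (rule vintage_value_terminal)

text \<open>Values look only forward in time; this makes it possible to redirect a policy at one date
  without changing the continuation values that it realizes afterwards.\<close>

lemma vintage_value_cong_policy:
  assumes "\<And>i. j \<le> i \<Longrightarrow> \<pi> i = \<pi>' i" "j \<le> horizon M"
  shows "vintage_value M R \<pi> \<sigma> j k = vintage_value M R \<pi>' \<sigma> j k"
  using assms(2,1)
proof (induction j arbitrary: k rule: inc_induct)
  case base
  show ?case by (simp add: vintage_value_terminal)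
next
  case (step j)
  then show ?case by (simp add: vintage_value_step)
qed

lemma not_future_equiv_imp_values_differ:
  assumes wf: "wf_tree M" and vint: "s \<le> t" "s' \<le> t" and "\<not> future_equiv M t h s s'"
    and rich: "locally_continuation_rich M t h \<R>"
  obtains R \<pi> j k where "R \<in> \<R>" "continuation_policy M t h \<pi>"
    "t \<le> j" "j < horizon M" "k \<in> subtree M h j"
    "vintage_value M R \<pi> s j k \<noteq> vintage_value M R \<pi> s' j k"
proof -
  obtain j k a where jk: "t \<le> j" "j < horizon M" "k \<in> subtree M h j" and a: "a \<in> actions M j k"
    and D: "D_op (observations M (Suc j) k a) (kernels M s j k a) (kernels M s' j k a) \<noteq> 0"
    using assms(4) by (auto simp: future_equiv_def)
  let ?Y = "observations M (Suc j) k a"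
  let ?E = "\<lambda>\<sigma> z. INF q\<in>kernels M \<sigma> j k a. \<Sum>y\<in>?Y. q y * (z y :: real)"
  have Y: "finite ?Y" by (rule wf_tree_kernel[OF wf jk(2,3) a])
  have K: "kernels M \<sigma> j k a \<noteq> {}" "kernels M \<sigma> j k a \<subseteq> prob_simplex ?Y" if "\<sigma> \<le> t" for \<sigma>
    using that jk(1) wf_tree_kernel(2,3)[OF wf jk(2,3) a, of \<sigma>] by auto
  obtain z where z: "\<forall>y\<in>?Y. \<bar>z y\<bar> \<le> 1" "?E s z \<noteq> ?E s' z"
    using D unfolding D_op_eq_0_iff[OF K[OF vint(1)] K[OF vint(2)]] by auto
  obtain \<epsilon> where \<epsilon>: "0 < \<epsilon>"
    "\<And>z. \<forall>y\<in>?Y. \<bar>z y\<bar> \<le> \<epsilon> \<Longrightarrow> \<exists>R\<in>\<R>. \<exists>\<pi>. continuation_policy M t h \<pi> \<and>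
      (\<forall>y\<in>?Y. \<forall>\<sigma>\<le>t. vintage_value M R \<pi> \<sigma> (Suc j) (Step k a y) = z y)"
    using rich jk a unfolding locally_continuation_rich_def by blast
  have "\<forall>y\<in>?Y. \<bar>\<epsilon> * z y\<bar> \<le> \<epsilon>" using z(1) \<epsilon>(1) by (simp add: abs_mult)
  from \<epsilon>(2)[OF this] obtain R \<pi> where R: "R \<in> \<R>" and \<pi>: "continuation_policy M t h \<pi>"
    and V: "\<forall>y\<in>?Y. \<forall>\<sigma>\<le>t. vintage_value M R \<pi> \<sigma> (Suc j) (Step k a y) = \<epsilon> * z y"
    by blast
  \<comment> \<open>The richness condition says nothing about the action that \<open>\<pi>\<close> takes at \<open>k\<close> itself.\<close>
  define \<pi>' where "\<pi>' = \<pi>(j := (\<pi> j)(k := a))"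
  have \<pi>': "continuation_policy M t h \<pi>'"
    using \<pi> a by (auto simp: continuation_policy_def \<pi>'_def)
  have "vintage_value M R \<pi>' \<sigma> (Suc j) (Step k a y) = \<epsilon> * z y" if "y \<in> ?Y" "\<sigma> \<le> t" for y \<sigma>
    using that V jk(2) vintage_value_cong_policy[of "Suc j" \<pi>' \<pi>] by (simp add: \<pi>'_def)
  then have "vintage_value M R \<pi>' \<sigma> j k = stage_reward R j k a + discount M * (\<epsilon> * ?E \<sigma> z)"
    if "\<sigma> \<le> t" for \<sigma>
    using that jk(2) INF_expectation_scale[OF Y K[OF that] \<epsilon>(1), of z]
    by (simp add: vintage_value_step \<pi>'_def cong: sum.cong)
  then have "vintage_value M R \<pi>' s j k \<noteq> vintage_value M R \<pi>' s' j k"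
    using z(2) \<epsilon>(1) vint wf by (simp add: wf_tree_def)
  with that R \<pi>' jk show thesis by blast
qed

lemma vintage_class_members:
  assumes "wf_tree M" "c \<in> vintage_classes M t h" "\<sigma> \<in> c"
  shows "\<sigma> \<le> t"
    and "c' \<in> vintage_classes M t h \<Longrightarrow> \<sigma>' \<in> c' \<Longrightarrow> c = c' \<longleftrightarrow> future_equiv M t h \<sigma> \<sigma>'"
proof -
  note eq = equiv_vintage_rel[OF assms(1), of t h]
  have le: "\<sigma> \<le> t" if "c \<in> vintage_classes M t h" "\<sigma> \<in> c" for c \<sigma>
    using in_quotient_imp_subset[OF eq] that unfolding vintage_classes_def by blast
  show "\<sigma> \<le> t" using le assms(2,3) .
  assume c': "c' \<in> vintage_classes M t h" "\<sigma>' \<in> c'"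
  then have "c = c' \<longleftrightarrow> (\<sigma>, \<sigma>') \<in> vintage_rel M t h"
    using quotient_eq_iff[OF eq _ _ assms(3) c'(2)] assms(2) by (simp add: vintage_classes_def)
  with le[OF assms(2,3)] le[OF c'] show "c = c' \<longleftrightarrow> future_equiv M t h \<sigma> \<sigma>'"
    by (simp add: vintage_rel_def)
qed

theorem proposition6p6:
  fixes M :: "('i, 'a, 'y) evaluation_tree"
    and h :: "('i, 'a, 'y) history"
    and t s s' :: nat
  assumes "wf_tree M"
    and "t < horizon M"
    and "h \<in> histories M t"
    and "s \<le> t" and "s' \<le> t"
  shows
    "(future_equiv M t h s s' \<longrightarrow>
        (\<forall>R \<pi>. bounded_rewards M R \<and> continuation_policy M t h \<pi> \<longrightarrow>
           (\<forall>j k. t \<le> j \<and> j \<le> horizon M \<and> k \<in> subtree M h j \<longrightarrow>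
              vintage_value M R \<pi> s j k = vintage_value M R \<pi> s' j k)))
     \<and>
     (\<forall>\<R>. \<not> future_equiv M t h s s' \<and> (\<forall>R\<in>\<R>. bounded_rewards M R) \<and>
           locally_continuation_rich M t h \<R> \<longrightarrow>
        (\<exists>R\<in>\<R>. \<exists>\<pi>. bounded_rewards M R \<and> continuation_policy M t h \<pi> \<and>
           (\<exists>j k. t \<le> j \<and> j \<le> horizon M \<and> k \<in> subtree M h j \<and>
              vintage_value M R \<pi> s j k \<noteq> vintage_value M R \<pi> s' j k)))
     \<and>
     (\<forall>\<rho> R \<pi>. (\<forall>c\<in>vintage_classes M t h. \<rho> c \<in> c) \<and>
           bounded_rewards M R \<and> continuation_policy M t h \<pi> \<longrightarrow>
        (\<forall>c\<in>vintage_classes M t h. \<forall>\<sigma>\<in>c. \<forall>j k.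
           t \<le> j \<and> j \<le> horizon M \<and> k \<in> subtree M h j \<longrightarrow>
             vintage_value M R \<pi> \<sigma> j k = vintage_value M R \<pi> (\<rho> c) j k) \<and>
        (\<exists>W. class_recursion M t h \<rho> R \<pi> W) \<and>
        (\<forall>W. class_recursion M t h \<rho> R \<pi> W \<longrightarrow>
           (\<forall>c\<in>vintage_classes M t h. \<forall>\<sigma>\<in>c. \<forall>j k.
              t \<le> j \<and> j \<le> horizon M \<and> k \<in> subtree M h j \<longrightarrow>
                vintage_value M R \<pi> \<sigma> j k = W c j k)))
     \<and>
     (\<forall>\<R>. (\<forall>R\<in>\<R>. bounded_rewards M R) \<and> locally_continuation_rich M t h \<R> \<longrightarrow>
        (\<forall>c\<in>vintage_classes M t h. \<forall>c'\<in>vintage_classes M t h. c \<noteq> c' \<longrightarrow>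
           (\<forall>\<sigma>\<in>c. \<forall>\<sigma>'\<in>c'. \<not> universally_identified M t h \<R> \<sigma> \<sigma>')))"
proof (intro conjI)
  show "future_equiv M t h s s' \<longrightarrow>
        (\<forall>R \<pi>. bounded_rewards M R \<and> continuation_policy M t h \<pi> \<longrightarrow>
           (\<forall>j k. t \<le> j \<and> j \<le> horizon M \<and> k \<in> subtree M h j \<longrightarrow>
              vintage_value M R \<pi> s j k = vintage_value M R \<pi> s' j k))"
    using assms(1,4,5) future_equiv_imp_values_eq by blast
next
  show "\<forall>\<R>. \<not> future_equiv M t h s s' \<and> (\<forall>R\<in>\<R>. bounded_rewards M R) \<and>
           locally_continuation_rich M t h \<R> \<longrightarrow>
        (\<exists>R\<in>\<R>. \<exists>\<pi>. bounded_rewards M R \<and> continuation_policy M t h \<pi> \<and>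
           (\<exists>j k. t \<le> j \<and> j \<le> horizon M \<and> k \<in> subtree M h j \<and>
              vintage_value M R \<pi> s j k \<noteq> vintage_value M R \<pi> s' j k))"
    using assms(1,4,5) by (metis not_future_equiv_imp_values_differ less_imp_le)
next
  show "\<forall>\<rho> R \<pi>. (\<forall>c\<in>vintage_classes M t h. \<rho> c \<in> c) \<and>
           bounded_rewards M R \<and> continuation_policy M t h \<pi> \<longrightarrow>
        (\<forall>c\<in>vintage_classes M t h. \<forall>\<sigma>\<in>c. \<forall>j k.
           t \<le> j \<and> j \<le> horizon M \<and> k \<in> subtree M h j \<longrightarrow>
             vintage_value M R \<pi> \<sigma> j k = vintage_value M R \<pi> (\<rho> c) j k) \<and>
        (\<exists>W. class_recursion M t h \<rho> R \<pi> W) \<and>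
        (\<forall>W. class_recursion M t h \<rho> R \<pi> W \<longrightarrow>
           (\<forall>c\<in>vintage_classes M t h. \<forall>\<sigma>\<in>c. \<forall>j k.
              t \<le> j \<and> j \<le> horizon M \<and> k \<in> subtree M h j \<longrightarrow>
                vintage_value M R \<pi> \<sigma> j k = W c j k))"
  proof (intro allI impI, elim conjE)
    fix \<rho> R \<pi>
    assume \<rho>: "\<forall>c\<in>vintage_classes M t h. \<rho> c \<in> c" and \<pi>: "continuation_policy M t h \<pi>"
    have same: "\<forall>c\<in>vintage_classes M t h. \<forall>\<sigma>\<in>c. \<forall>j k.
        t \<le> j \<and> j \<le> horizon M \<and> k \<in> subtree M h j \<longrightarrow>
          vintage_value M R \<pi> \<sigma> j k = vintage_value M R \<pi> (\<rho> c) j k"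
    proof (intro ballI allI impI, elim conjE)
      fix c \<sigma> j k
      assume c: "c \<in> vintage_classes M t h" "\<sigma> \<in> c"
        and jk: "t \<le> j" "j \<le> horizon M" "k \<in> subtree M h j"
      have \<rho>c: "\<rho> c \<in> c" using \<rho> c(1) by blast
      have "future_equiv M t h \<sigma> (\<rho> c)"
        using vintage_class_members(2)[OF assms(1) c c(1) \<rho>c] by simp
      then show "vintage_value M R \<pi> \<sigma> j k = vintage_value M R \<pi> (\<rho> c) j k"
        using future_equiv_imp_values_eq[OF assms(1) _ _ _ \<pi> jk]
          vintage_class_members(1)[OF assms(1) c(1)] c(2) \<rho>c by blast
    qed
    have exists: "\<exists>W. class_recursion M t h \<rho> R \<pi> W"
      by (rule exI[of _ "\<lambda>c. vintage_value M R \<pi> (\<rho> c)"])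
        (auto simp: class_recursion_def vintage_value_terminal vintage_value_step)
    have "\<forall>c\<in>vintage_classes M t h. \<forall>\<sigma>\<in>c. \<forall>j k.
        t \<le> j \<and> j \<le> horizon M \<and> k \<in> subtree M h j \<longrightarrow> vintage_value M R \<pi> \<sigma> j k = W c j k"
      if W: "class_recursion M t h \<rho> R \<pi> W" for W
    proof (intro ballI allI impI, elim conjE)
      fix c \<sigma> j k
      assume c: "c \<in> vintage_classes M t h" "\<sigma> \<in> c"
        and jk: "t \<le> j" "j \<le> horizon M" "k \<in> subtree M h j"
      have "vintage_value M R \<pi> (\<rho> c) j k = W c j k"
        using W c(1) by (intro vintage_value_unique[OF \<pi> _ _ jk(2,1,3)])
          (auto simp: class_recursion_def)
      with same c jk show "vintage_value M R \<pi> \<sigma> j k = W c j k" by simp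
    qed
    with same exists show "(\<forall>c\<in>vintage_classes M t h. \<forall>\<sigma>\<in>c. \<forall>j k.
           t \<le> j \<and> j \<le> horizon M \<and> k \<in> subtree M h j \<longrightarrow>
             vintage_value M R \<pi> \<sigma> j k = vintage_value M R \<pi> (\<rho> c) j k) \<and>
        (\<exists>W. class_recursion M t h \<rho> R \<pi> W) \<and>
        (\<forall>W. class_recursion M t h \<rho> R \<pi> W \<longrightarrow>
           (\<forall>c\<in>vintage_classes M t h. \<forall>\<sigma>\<in>c. \<forall>j k.
              t \<le> j \<and> j \<le> horizon M \<and> k \<in> subtree M h j \<longrightarrow>
                vintage_value M R \<pi> \<sigma> j k = W c j k))"
      by (intro conjI allI impI)
  qed
next
  show "\<forall>\<R>. (\<forall>R\<in>\<R>. bounded_rewards M R) \<and> locally_continuation_rich M t h \<R> \<longrightarrow>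
        (\<forall>c\<in>vintage_classes M t h. \<forall>c'\<in>vintage_classes M t h. c \<noteq> c' \<longrightarrow>
           (\<forall>\<sigma>\<in>c. \<forall>\<sigma>'\<in>c'. \<not> universally_identified M t h \<R> \<sigma> \<sigma>'))"
  proof (intro allI impI ballI notI, elim conjE)
    fix \<R> c c' \<sigma> \<sigma>'
    assume rich: "locally_continuation_rich M t h \<R>"
      and c: "c \<in> vintage_classes M t h" "c' \<in> vintage_classes M t h" "c \<noteq> c'" "\<sigma> \<in> c" "\<sigma>' \<in> c'"
      and ident: "universally_identified M t h \<R> \<sigma> \<sigma>'"
    have "\<sigma> \<le> t" "\<sigma>' \<le> t" "\<not> future_equiv M t h \<sigma> \<sigma>'"
      using c vintage_class_members[OF assms(1)] by blast+
    from not_future_equiv_imp_values_differ[OF assms(1) this rich] ident show False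
      unfolding universally_identified_def by (metis less_imp_le)
  qed
qed

end
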